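(* Let $p=p_n\to\infty$ with $p/n\to0$. Let $\mathcal P=\{P_d:d\in S^{p-1}\}$ be the collection of all change plane models such that the distribution $P_d$ of $(X,Y)$ (equivalently, of $(X,\xi)$), with $X\in\mathbb R^p$, satisfies $$Y=\mathbf 1_{X^\top d>0}+\xi,$$ where $X$ is independent of $\xi$ and $\xi$ is symmetric about the origin. Then there is a constant $K>0$ such that, for all sufficiently large $n$, $$\inf_{\hat d}\ \sup_{P_d\in\mathcal P}\ \mathbb E_{d}\big(\operatorname{dist}^2(\hat d,d)\big)\ \ge\ K\,\frac pn\Big(1+\log\frac np\Big),$$ where $\operatorname{dist}(d_1,d_2)=\sqrt{\mathbb P\big(\operatorname{sign}(X^\top d_1)\ne\operatorname{sign}(X^\top d_2)\big)}$.
   Context: The infimum is over all estimators $\hat d\in S^{p-1}$ based on $n$ i.i.d. observations from $P_d$; $\mathbb E_d$ is expectation under these observations; the probability in $\operatorname{dist}$ is over $X$ with law given by $P_d$ (independent of the data). $S^{p-1}$ is the unit sphere of $\mathbb R^p$, and $\operatorname{sign}(x)=1$ if $x>0$, $-1$ if $x\le0$. *)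

theory Defs
  imports "HOL-Probability.Probability"
begin

text \<open>
  The dimension varies with the sample size, so vectors of length \<open>p\<close> are the extensional
  functions on \<open>{..<p}\<close>; the product sigma-algebra below is the Borel sigma-algebra of Euclidean \<open>p\<close>-space.
\<close>

abbreviation euclid :: "nat \<Rightarrow> (nat \<Rightarrow> real) measure" where
  "euclid p \<equiv> \<Pi>\<^sub>M i\<in>{..<p}. borel"

definition dot :: "nat \<Rightarrow> (nat \<Rightarrow> real) \<Rightarrow> (nat \<Rightarrow> real) \<Rightarrow> real" where
  "dot p x d = (\<Sum>i<p. x i * d i)"

definition unit_sphere :: "nat \<Rightarrow> (nat \<Rightarrow> real) set" where
  "unit_sphere p = {d \<in> space (euclid p). L2_set d {..<p} = 1}"

text \<open>Unlike \<^const>\<open>sgn\<close>, this takes the value \<open>-1\<close> at \<open>0\<close>.\<close>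

definition plane_sign :: "real \<Rightarrow> real" where
  "plane_sign x = (if x > 0 then 1 else -1)"

text \<open>
  \<open>Q\<close> is the joint law of \<open>(X, \<xi>)\<close>: any law of \<open>X\<close> is allowed, and any symmetric law of \<open>\<xi>\<close>.
  Independence is that of the generated sigma-algebras, because \<open>prob_space.indep_var\<close> needs both
  variables to have the same type.
\<close>

definition covariate_noise_law :: "nat \<Rightarrow> ((nat \<Rightarrow> real) \<times> real) measure \<Rightarrow> bool" where
  "covariate_noise_law p Q \<longleftrightarrow>
     prob_space Q \<and> sets Q = sets (euclid p \<Otimes>\<^sub>M borel) \<and>
     prob_space.indep_set Q
       (sets (vimage_algebra (space Q) fst (euclid p)))
       (sets (vimage_algebra (space Q) snd borel)) \<and>
     distr Q borel (\<lambda>z. - snd z) = distr Q borel snd"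

definition change_plane_law ::
    "nat \<Rightarrow> (nat \<Rightarrow> real) \<Rightarrow> ((nat \<Rightarrow> real) \<times> real) measure \<Rightarrow> ((nat \<Rightarrow> real) \<times> real) measure" where
  "change_plane_law p d Q =
     distr Q (euclid p \<Otimes>\<^sub>M borel) (\<lambda>(x, \<xi>). (x, indicator {0<..} (dot p x d) + \<xi>))"

text \<open>
  A model is recorded as the pair of its parameter \<open>d\<close> and the law \<open>P\<close> of \<open>(X, Y)\<close>, since \<open>P\<close>
  alone need not determine \<open>d\<close>.
\<close>

definition change_plane_models ::
    "nat \<Rightarrow> ((nat \<Rightarrow> real) \<times> ((nat \<Rightarrow> real) \<times> real) measure) set" where
  "change_plane_models p =
     {(d, change_plane_law p d Q) | d Q. d \<in> unit_sphere p \<and> covariate_noise_law p Q}"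

definition plane_dist ::
    "nat \<Rightarrow> ((nat \<Rightarrow> real) \<times> real) measure \<Rightarrow> (nat \<Rightarrow> real) \<Rightarrow> (nat \<Rightarrow> real) \<Rightarrow> real" where
  "plane_dist p P d1 d2 =
     sqrt (measure P {(x, y) \<in> space P. plane_sign (dot p x d1) \<noteq> plane_sign (dot p x d2)})"

definition estimators ::
    "nat \<Rightarrow> nat \<Rightarrow> ((nat \<Rightarrow> (nat \<Rightarrow> real) \<times> real) \<Rightarrow> (nat \<Rightarrow> real)) set" where
  "estimators n p =
     (\<Pi>\<^sub>M i\<in>{..<n}. euclid p \<Otimes>\<^sub>M borel) \<rightarrow>\<^sub>M restrict_space (euclid p) (unit_sphere p)"

text \<open>
  The loss is bounded by \<open>1\<close> and nonnegative; the risk is computed in \<^typ>\<open>ennreal\<close>, where the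
  infimum and supremum are those of a complete lattice.
\<close>

definition plane_risk ::
    "nat \<Rightarrow> nat \<Rightarrow> ((nat \<Rightarrow> (nat \<Rightarrow> real) \<times> real) \<Rightarrow> (nat \<Rightarrow> real)) \<Rightarrow>
     (nat \<Rightarrow> real) \<Rightarrow> ((nat \<Rightarrow> real) \<times> real) measure \<Rightarrow> ennreal" where
  "plane_risk n p dhat d P =
     (\<integral>\<^sup>+ data. ennreal ((plane_dist p P (dhat data) d)\<^sup>2) \<partial>(\<Pi>\<^sub>M i\<in>{..<n}. P))"

end

theory Submission
  imports Defs "HOL-Computational_Algebra.Polynomial"
begin

text \<open>
  A discrete law of \<open>X\<close> already forces the rate. On the moment curve \<open>i \<mapsto> (1, i, i\<^sup>2, \<dots>)\<close> the
  planes through the origin cut out every set of at most \<open>D\<close> points, as soon as \<open>2 * D < p\<close>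
  (\<open>moment_curve_subset_cut\<close>). Hence, with \<open>X\<close> uniform on the first \<open>N\<close> of these points,
  estimating \<open>d\<close> means recovering a sparse subset of \<open>N\<close> points from observations of its
  indicator function in noise, and the squared distance is the proportion of misclassified
  points.

  The noise is the source of the logarithm. Without it, a single observation of a chosen point
  reveals that the point is chosen. With standard Gaussian noise, the number of observations that
  a chosen point needs to stand out grows like the logarithm of the number of its competitors.
  Split the points into \<open>D\<close> blocks of size \<open>M\<close> and let the subset contain one uniformly random
  point of each block. Compare the model with the one in which the chosen point of block \<open>j\<close> is
  removed. In the latter model the choice in block \<open>j\<close> leaves no trace, so it is guessed with
  probability at most \<open>1 / M\<close>. The likelihood ratio between the two models has second moment at
  most \<open>(1 + 2 / N) ^ n \<le> exp (2 * n / N)\<close> over \<open>n\<close> observations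
  (\<open>gaussian_ratio_second_moment_single\<close>), and so as long as this is at most \<open>M / 4\<close> the true
  choice is identified with probability at most \<open>1 / 2\<close> (\<open>likelihood_ratio_event_bound\<close>). On
  average at least half of the blocks contain an error, and the risk is at least
  \<open>D / (2 * N) = 1 / (2 * M)\<close> (\<open>block_prior_risk_bound\<close>).

  With \<open>u = n / p\<close> and \<open>D\<close> of order \<open>p\<close>, the constraint is \<open>exp (8 * u / M) \<le> M / 4\<close>, which
  \<open>M \<approx> 16 * u / ln u\<close> satisfies (\<open>block_size_exists\<close>). Then \<open>1 / M\<close> is of order \<open>(ln u) / u\<close>, the
  claimed rate.
\<close>

section \<open>Change of measure for independent observations\<close>

lemma PiM_density_power:
  fixes L :: "'a \<Rightarrow> ennreal"
  assumes "prob_space P" "prob_space (density P L)" "L \<in> borel_measurable P" "finite I"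
  shows "PiM I (\<lambda>_. density P L) = density (PiM I (\<lambda>_. P)) (\<lambda>\<omega>. \<Prod>i\<in>I. L (\<omega> i))"
proof -
  interpret P: product_sigma_finite "\<lambda>_. P"
    by (intro product_sigma_finite.intro prob_space_imp_sigma_finite assms)
  interpret Q: product_sigma_finite "\<lambda>_. density P L"
    by (intro product_sigma_finite.intro prob_space_imp_sigma_finite assms)
  note [measurable] = assms(3)
  show ?thesis
  proof (rule Q.PiM_eqI[symmetric])
    show "sets (density (PiM I (\<lambda>_. P)) (\<lambda>\<omega>. \<Prod>i\<in>I. L (\<omega> i))) = sets (PiM I (\<lambda>_. density P L))"
      by (auto intro!: sets_PiM_cong)
    fix A assume A: "\<And>i. i \<in> I \<Longrightarrow> A i \<in> sets (density P L)"
    then have A': "\<And>i. i \<in> I \<Longrightarrow> A i \<in> sets P" by simp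
    then have [measurable]: "Pi\<^sub>E I A \<in> sets (PiM I (\<lambda>_. P))"
      using assms(4) by (intro sets_PiM_I_finite) auto
    have "emeasure (density (PiM I (\<lambda>_. P)) (\<lambda>\<omega>. \<Prod>i\<in>I. L (\<omega> i))) (Pi\<^sub>E I A)
        = (\<integral>\<^sup>+\<omega>. (\<Prod>i\<in>I. L (\<omega> i)) * indicator (Pi\<^sub>E I A) \<omega> \<partial>PiM I (\<lambda>_. P))"
      by (subst emeasure_density) auto
    also have "\<dots> = (\<integral>\<^sup>+\<omega>. (\<Prod>i\<in>I. L (\<omega> i) * indicator (A i) (\<omega> i)) \<partial>PiM I (\<lambda>_. P))"
    proof (rule nn_integral_cong)
      fix \<omega> assume "\<omega> \<in> space (PiM I (\<lambda>_. P))"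
      then have "indicator (Pi\<^sub>E I A) \<omega> = (\<Prod>i\<in>I. indicator (A i) (\<omega> i) :: ennreal)"
        using assms(4) by (auto simp: indicator_def space_PiM PiE_iff prod_zero_iff)
      then show "(\<Prod>i\<in>I. L (\<omega> i)) * indicator (Pi\<^sub>E I A) \<omega> = (\<Prod>i\<in>I. L (\<omega> i) * indicator (A i) (\<omega> i))"
        by (simp add: prod.distrib)
    qed
    also have "\<dots> = (\<Prod>i\<in>I. \<integral>\<^sup>+x. L x * indicator (A i) x \<partial>P)"
      using assms(4) A' by (subst P.product_nn_integral_prod[where f="\<lambda>i x. L x * indicator (A i) x"]) auto
    also have "\<dots> = (\<Prod>i\<in>I. emeasure (density P L) (A i))"
      using A' by (intro prod.cong refl) (simp add: emeasure_density)
    finally show "emeasure (density (PiM I (\<lambda>_. P)) (\<lambda>\<omega>. \<Prod>i\<in>I. L (\<omega> i))) (Pi\<^sub>E I A) = \<dots>" .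
  qed (use assms in auto)
qed

text \<open>
  An event that is rare under \<open>P\<close> cannot be likely after a change of measure whose likelihood ratio
  \<open>r\<close> is square integrable: integrate the inequality \<open>r \<le> a * r\<^sup>2 + 1 / (4 * a)\<close> over the event.
  For independent observations the second moment of \<open>r\<close> is a power.
\<close>

lemma likelihood_ratio_event_bound:
  fixes l :: "'a \<Rightarrow> real"
  assumes "prob_space P" "prob_space (density P l)"
    and [measurable]: "l \<in> borel_measurable P" and nonneg: "\<And>x. 0 \<le> l x"
    and moment: "(\<integral>\<^sup>+x. ennreal ((l x)\<^sup>2) \<partial>P) \<le> ennreal b" and "0 \<le> b"
    and "finite I" "0 < a" and [measurable]: "A \<in> sets (PiM I (\<lambda>_. P))"
  shows "measure (PiM I (\<lambda>_. density P l)) A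
           \<le> a * b ^ card I + measure (PiM I (\<lambda>_. P)) A / (4 * a)"
proof -
  interpret P: product_sigma_finite "\<lambda>_. P"
    by (intro product_sigma_finite.intro prob_space_imp_sigma_finite assms)
  interpret PP: prob_space "PiM I (\<lambda>_. P)" by (intro prob_space_PiM assms)
  interpret QQ: prob_space "PiM I (\<lambda>_. density P l)" by (intro prob_space_PiM assms)
  have "emeasure (PiM I (\<lambda>_. density P l)) A
      = (\<integral>\<^sup>+\<omega>. (\<Prod>i\<in>I. ennreal (l (\<omega> i))) * indicator A \<omega> \<partial>PiM I (\<lambda>_. P))"
    using assms by (subst PiM_density_power) (auto simp: emeasure_density)
  also have "\<dots> \<le> (\<integral>\<^sup>+\<omega>. ennreal a * (\<Prod>i\<in>I. ennreal ((l (\<omega> i))\<^sup>2))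
                      + ennreal (1 / (4 * a)) * indicator A \<omega> \<partial>PiM I (\<lambda>_. P))"
  proof (rule nn_integral_mono)
    fix \<omega>
    define r where "r = (\<Prod>i\<in>I. l (\<omega> i))"
    have r: "0 \<le> r" by (simp add: r_def prod_nonneg nonneg)
    have "0 \<le> (2 * a * r - 1)\<^sup>2" by simp
    then have "r \<le> a * r\<^sup>2 + 1 / (4 * a)"
      using \<open>0 < a\<close> by (simp add: field_simps power2_eq_square)
    then have "ennreal r * indicator A \<omega> \<le> ennreal a * ennreal (r\<^sup>2) + ennreal (1 / (4 * a)) * indicator A \<omega>"
      using \<open>0 < a\<close> r by (auto simp: indicator_def ennreal_mult[symmetric] ennreal_plus[symmetric]
          simp del: ennreal_plus intro!: ennreal_leI)
    then show "(\<Prod>i\<in>I. ennreal (l (\<omega> i))) * indicator A \<omega>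
        \<le> ennreal a * (\<Prod>i\<in>I. ennreal ((l (\<omega> i))\<^sup>2)) + ennreal (1 / (4 * a)) * indicator A \<omega>"
      by (simp add: prod_ennreal nonneg r_def prod_power_distrib)
  qed
  also have "\<dots> = ennreal a * (\<integral>\<^sup>+x. ennreal ((l x)\<^sup>2) \<partial>P) ^ card I
      + ennreal (1 / (4 * a)) * emeasure (PiM I (\<lambda>_. P)) A"
    using \<open>finite I\<close>
    by (simp add: nn_integral_add nn_integral_cmult P.product_nn_integral_prod[where f="\<lambda>i x. ennreal ((l x)\<^sup>2)"])
  also have "\<dots> \<le> ennreal a * ennreal b ^ card I + ennreal (1 / (4 * a)) * emeasure (PiM I (\<lambda>_. P)) A"
    by (intro add_mono mult_left_mono power_mono moment) auto
  also have "\<dots> = ennreal (a * b ^ card I + measure (PiM I (\<lambda>_. P)) A / (4 * a))"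
    using \<open>0 < a\<close> \<open>0 \<le> b\<close>
    by (simp add: PP.emeasure_eq_measure ennreal_mult[symmetric] ennreal_power ennreal_plus[symmetric]
        del: ennreal_plus)
  finally show ?thesis
    using \<open>0 < a\<close> \<open>0 \<le> b\<close> by (simp add: QQ.emeasure_eq_measure del: ennreal_plus)
qed

section \<open>Planes that cut subsets out of the moment curve\<close>

definition moment_point :: "nat \<Rightarrow> nat \<Rightarrow> nat \<Rightarrow> real" where
  "moment_point p i = (\<lambda>k\<in>{..<p}. real i ^ k)"

lemma moment_point_in_space [simp]: "moment_point p i \<in> space (euclid p)"
  by (simp add: moment_point_def space_PiM)

text \<open>
  A direction is the coefficient vector of a polynomial of degree less than \<open>p\<close>, and its inner product
  with a point of the curve is the value of the polynomial. The polynomial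
  \<open>1 / 2 - (\<Prod>j\<in>T. (t - j)\<^sup>2)\<close> is \<open>1 / 2\<close> on \<open>T\<close> and at most \<open>- 1 / 2\<close> at the other integers.
\<close>

lemma moment_curve_subset_cut:
  assumes "finite T" "2 * card T < p"
  shows "\<exists>d\<in>unit_sphere p. \<forall>i. 0 < dot p (moment_point p i) d \<longleftrightarrow> i \<in> T"
proof -
  define r :: "real poly" where "r = (\<Prod>j\<in>T. [:- real j, 1:] ^ 2)"
  define q where "q = [:1/2:] - r"
  have poly_r: "poly r (real i) = (\<Prod>j\<in>T. (real i - real j)\<^sup>2)" for i
    by (simp add: r_def poly_prod algebra_simps)
  have q_pos: "0 < poly q (real i) \<longleftrightarrow> i \<in> T" for i
  proof (cases "i \<in> T")
    case True
    then have "poly r (real i) = 0" using assms(1) by (auto simp: poly_r intro!: prod_zero)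
    then show ?thesis using True by (simp add: q_def)
  next
    case False
    have "(1::real) \<le> (real i - real j)\<^sup>2" if "j \<in> T" for j
    proof -
      have "i \<noteq> j" using that False by auto
      then have "1 \<le> \<bar>real i - real j\<bar>" by linarith
      then show ?thesis by (simp add: abs_le_square_iff[symmetric, of 1, simplified])
    qed
    then have "1 \<le> poly r (real i)" unfolding poly_r by (intro prod_ge_1) auto
    then show ?thesis using False by (simp add: q_def)
  qed
  have "degree r \<le> (\<Sum>j\<in>T. degree ([:- real j, 1:] ^ 2))"
    unfolding r_def using degree_prod_sum_le[OF assms(1)] by (simp add: o_def)
  also have "\<dots> = 2 * card T" by (simp add: degree_power_eq)
  finally have "degree q < p"
    using assms(2) unfolding q_def by (intro degree_diff_less) auto
  then have expand: "poly q x = (\<Sum>k<p. coeff q k * x ^ k)" for x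
    unfolding poly_altdef by (intro sum.mono_neutral_left) (auto simp: coeff_eq_0 not_le)
  define c where "c = L2_set (coeff q) {..<p}"
  \<comment> \<open>The constant coefficient of \<open>q\<close> is one half minus an integer.\<close>
  have "c \<noteq> 0"
  proof
    assume "c = 0"
    then have "poly q (real 0) = 0"
      unfolding expand c_def by (simp add: L2_set_eq_0_iff)
    moreover have "poly r (real 0) = of_int (\<Prod>j\<in>T. (int j)\<^sup>2)" using poly_r[of 0] by simp
    ultimately have "real_of_int (2 * (\<Prod>j\<in>T. (int j)\<^sup>2)) = real_of_int 1" by (simp add: q_def)
    then have "2 * (\<Prod>j\<in>T. (int j)\<^sup>2) = 1" by (simp only: of_int_eq_iff)
    then show False by presburger
  qed
  moreover have "0 \<le> c" by (simp add: c_def)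
  ultimately have c: "0 < c" by simp
  define d where "d = (\<lambda>k\<in>{..<p}. coeff q k / c)"
  have "L2_set d {..<p} = L2_set (\<lambda>k. (1 / c) * coeff q k) {..<p}"
    by (rule L2_set_cong) (auto simp: d_def)
  also have "\<dots> = 1" using c by (subst L2_set_right_distrib[symmetric]) (auto simp: c_def[symmetric])
  finally have "d \<in> unit_sphere p" by (simp add: unit_sphere_def d_def space_PiM)
  moreover have "dot p (moment_point p i) d = poly q (real i) / c" for i
    unfolding dot_def expand by (auto simp: moment_point_def d_def sum_divide_distrib intro!: sum.cong)
  ultimately show ?thesis using c q_pos by (intro bexI[of _ d]) (auto simp: zero_less_divide_iff)
qed

section \<open>Gaussian change plane models on the moment curve\<close>

lemma covariate_noise_law_product:
  assumes "prob_space \<mu>" "sets \<mu> = sets (euclid p)"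
    and "prob_space \<kappa>" "sets \<kappa> = sets borel" "distr \<kappa> borel uminus = \<kappa>"
  shows "covariate_noise_law p (\<mu> \<Otimes>\<^sub>M \<kappa>)"
proof -
  interpret \<mu>: prob_space \<mu> by fact
  interpret \<kappa>: prob_space \<kappa> by fact
  interpret Q: pair_prob_space \<mu> \<kappa> ..
  note [measurable_cong] = assms(2,4)
  have space: "space \<mu> = space (euclid p)" "space \<kappa> = UNIV"
    using sets_eq_imp_space_eq[OF assms(2)] sets_eq_imp_space_eq[OF assms(4)] by auto
  have "Q.indep_set (sets (vimage_algebra (space (\<mu> \<Otimes>\<^sub>M \<kappa>)) fst (euclid p)))
          (sets (vimage_algebra (space (\<mu> \<Otimes>\<^sub>M \<kappa>)) snd borel))"
  proof (rule Q.indep_setI)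
    have "fst \<in> \<mu> \<Otimes>\<^sub>M \<kappa> \<rightarrow>\<^sub>M euclid p" "snd \<in> \<mu> \<Otimes>\<^sub>M \<kappa> \<rightarrow>\<^sub>M borel"
      by measurable
    then show "sets (vimage_algebra (space (\<mu> \<Otimes>\<^sub>M \<kappa>)) fst (euclid p)) \<subseteq> Q.events"
      "sets (vimage_algebra (space (\<mu> \<Otimes>\<^sub>M \<kappa>)) snd borel) \<subseteq> Q.events"
      by (simp_all add: measurable_iff_sets)
    fix a b
    assume a: "a \<in> sets (vimage_algebra (space (\<mu> \<Otimes>\<^sub>M \<kappa>)) fst (euclid p))"
      and b: "b \<in> sets (vimage_algebra (space (\<mu> \<Otimes>\<^sub>M \<kappa>)) snd borel)"
    from a obtain A where A: "A \<in> sets (euclid p)" "a = fst -` A \<inter> space (\<mu> \<Otimes>\<^sub>M \<kappa>)"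
      by (subst (asm) sets_vimage_algebra2) (auto simp: space_pair_measure space)
    from b obtain B where B: "B \<in> sets borel" "b = snd -` B \<inter> space (\<mu> \<Otimes>\<^sub>M \<kappa>)"
      by (subst (asm) sets_vimage_algebra2) (auto simp: space_pair_measure space)
    have "A \<subseteq> space \<mu>" using A(1) sets.sets_into_space space by blast
    then have "a = A \<times> space \<kappa>" "b = space \<mu> \<times> B" "a \<inter> b = A \<times> B"
      using A(2) B(2) by (auto simp: space_pair_measure space)
    moreover have "Q.prob (U \<times> V) = \<mu>.prob U * \<kappa>.prob V" if "U \<in> sets \<mu>" "V \<in> sets \<kappa>" for U V
      using that by (simp add: measure_def \<kappa>.emeasure_pair_measure_Times enn2real_mult)
    moreover have "A \<in> sets \<mu>" "B \<in> sets \<kappa>"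
      using A(1) B(1) assms(2,4) by simp_all
    ultimately show "Q.prob (a \<inter> b) = Q.prob a * Q.prob b"
      by (simp only: sets.top \<mu>.prob_space \<kappa>.prob_space mult_1 mult_1_right)
  qed
  moreover have "distr (\<mu> \<Otimes>\<^sub>M \<kappa>) borel snd = \<kappa>"
  proof (rule measure_eqI)
    fix A assume "A \<in> sets (distr (\<mu> \<Otimes>\<^sub>M \<kappa>) borel snd)"
    then have "A \<in> sets borel" by simp
    moreover have "snd -` A \<inter> space (\<mu> \<Otimes>\<^sub>M \<kappa>) = space \<mu> \<times> A"
      by (auto simp: space_pair_measure space)
    ultimately show "emeasure (distr (\<mu> \<Otimes>\<^sub>M \<kappa>) borel snd) A = emeasure \<kappa> A"
      using assms(4) by (simp add: emeasure_distr \<kappa>.emeasure_pair_measure_Times \<mu>.emeasure_space_1)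
  qed (use assms in simp)
  then have "distr (\<mu> \<Otimes>\<^sub>M \<kappa>) borel (\<lambda>z. - snd z) = distr (\<mu> \<Otimes>\<^sub>M \<kappa>) borel snd"
    using distr_distr[of uminus borel borel snd "\<mu> \<Otimes>\<^sub>M \<kappa>"] assms(5) by (simp add: o_def)
  ultimately show ?thesis
    unfolding covariate_noise_law_def
    using assms(2,4) Q.prob_space_axioms by (auto intro!: sets_pair_measure_cong)
qed

abbreviation plane_ind :: "nat \<Rightarrow> (nat \<Rightarrow> real) \<Rightarrow> (nat \<Rightarrow> real) \<Rightarrow> real" where
  "plane_ind p d x \<equiv> indicator {0<..} (dot p x d)"

lemma measurable_dot [measurable]: "(\<lambda>x. dot p x d) \<in> euclid p \<rightarrow>\<^sub>M borel"
  unfolding dot_def by measurable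

lemma measurable_dot_right: "(\<lambda>d. dot p x d) \<in> euclid p \<rightarrow>\<^sub>M borel"
  unfolding dot_def by measurable

definition moment_design :: "nat \<Rightarrow> nat \<Rightarrow> (nat \<Rightarrow> real) measure" where
  "moment_design N p = distr (measure_pmf (pmf_of_set {..<N})) (euclid p) (moment_point p)"

definition gaussian_model ::
    "nat \<Rightarrow> nat \<Rightarrow> (nat \<Rightarrow> real) \<Rightarrow> ((nat \<Rightarrow> real) \<times> real) measure" where
  "gaussian_model N p d =
     change_plane_law p d (moment_design N p \<Otimes>\<^sub>M density lborel (normal_density 0 1))"

lemma sets_moment_design [measurable_cong, simp]: "sets (moment_design N p) = sets (euclid p)"
  by (simp add: moment_design_def)

lemma sets_gaussian_model [measurable_cong, simp]:
  "sets (gaussian_model N p d) = sets (euclid p \<Otimes>\<^sub>M borel)"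
  by (simp add: gaussian_model_def change_plane_law_def)

lemma prob_space_moment_design: "prob_space (moment_design N p)"
  unfolding moment_design_def by (intro prob_space.prob_space_distr prob_space_measure_pmf) simp

lemma gaussian_model_admissible:
  assumes "d \<in> unit_sphere p"
  shows "(d, gaussian_model N p d) \<in> change_plane_models p"
proof -
  let ?\<kappa> = "density lborel (normal_density 0 1)"
  interpret \<kappa>: prob_space ?\<kappa> by (rule prob_space_normal_density) simp
  have "distributed ?\<kappa> lborel (\<lambda>x. x) (normal_density 0 1)"
    by (simp add: distributed_def distr_id2)
  then have "distributed ?\<kappa> lborel (\<lambda>x. 0 + - 1 * x) (normal_density (0 + - 1 * 0) (\<bar>- 1\<bar> * 1))"
    by (rule \<kappa>.normal_density_affine) auto
  then have "distr ?\<kappa> lborel uminus = ?\<kappa>"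
    by (simp add: distributed_def)
  then have "distr ?\<kappa> borel uminus = ?\<kappa>"
    by (simp cong: distr_cong)
  then have "covariate_noise_law p (moment_design N p \<Otimes>\<^sub>M ?\<kappa>)"
    by (intro covariate_noise_law_product prob_space_moment_design \<kappa>.prob_space_axioms) auto
  then show ?thesis
    using assms unfolding change_plane_models_def gaussian_model_def by blast
qed

lemma nn_integral_normal_density:
  "0 < \<sigma> \<Longrightarrow> (\<integral>\<^sup>+y. ennreal (normal_density \<mu> \<sigma> y) \<partial>lborel) = 1"
  using prob_space.emeasure_space_1[OF prob_space_normal_density] by (simp add: emeasure_density)

text \<open>
  Likelihood ratios and distances are computed from this formula, which says that the law of \<open>Y\<close> at each design point is the Gaussian with
  variance \<open>1\<close> centred at the indicator of the half-space.
\<close>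

lemma nn_integral_gaussian_model:
  fixes g :: "(nat \<Rightarrow> real) \<times> real \<Rightarrow> ennreal"
  assumes "0 < N" and [measurable]: "g \<in> borel_measurable (euclid p \<Otimes>\<^sub>M borel)"
  shows "nn_integral (gaussian_model N p d) g =
    (\<Sum>i<N. \<integral>\<^sup>+y. normal_density (plane_ind p d (moment_point p i)) 1 y
               * g (moment_point p i, y) \<partial>lborel) / N"
proof -
  let ?\<kappa> = "density lborel (normal_density 0 1)"
  interpret \<kappa>: prob_space ?\<kappa> by (rule prob_space_normal_density) simp
  have [measurable]: "(\<lambda>(x, \<xi>). (x, plane_ind p d x + \<xi>))
      \<in> moment_design N p \<Otimes>\<^sub>M ?\<kappa> \<rightarrow>\<^sub>M euclid p \<Otimes>\<^sub>M borel"
    by measurable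
  have [simp]: "{..<N} \<noteq> {}" using assms(1) by auto
  have shift: "(\<integral>\<^sup>+\<xi>. g (x, c + \<xi>) \<partial>?\<kappa>) = (\<integral>\<^sup>+y. normal_density c 1 y * g (x, y) \<partial>lborel)"
    if [measurable]: "x \<in> space (euclid p)" for x c
  proof -
    have "(\<integral>\<^sup>+y. normal_density c 1 y * g (x, y) \<partial>lborel)
        = (\<integral>\<^sup>+y. normal_density c 1 (c + 1 * y) * g (x, c + 1 * y) \<partial>lborel)"
      by (subst nn_integral_real_affine[where c=1 and t=c]) auto
    also have "\<dots> = (\<integral>\<^sup>+\<xi>. g (x, c + \<xi>) \<partial>?\<kappa>)"
      by (subst nn_integral_density) (auto simp: normal_density_def)
    finally show ?thesis ..
  qed
  have "nn_integral (gaussian_model N p d) g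
      = (\<integral>\<^sup>+z. g (case z of (x, \<xi>) \<Rightarrow> (x, plane_ind p d x + \<xi>)) \<partial>(moment_design N p \<Otimes>\<^sub>M ?\<kappa>))"
    unfolding gaussian_model_def change_plane_law_def by (subst nn_integral_distr) auto
  also have "\<dots> = (\<integral>\<^sup>+x. \<integral>\<^sup>+\<xi>. g (x, plane_ind p d x + \<xi>) \<partial>?\<kappa> \<partial>moment_design N p)"
    by (subst \<kappa>.nn_integral_fst[symmetric]) auto
  also have "\<dots> = (\<integral>\<^sup>+i. \<integral>\<^sup>+\<xi>. g (moment_point p i, plane_ind p d (moment_point p i) + \<xi>) \<partial>?\<kappa>
                      \<partial>measure_pmf (pmf_of_set {..<N}))"
    unfolding moment_design_def by (subst nn_integral_distr) auto
  also have "\<dots> = (\<Sum>i<N. \<integral>\<^sup>+\<xi>. g (moment_point p i, plane_ind p d (moment_point p i) + \<xi>) \<partial>?\<kappa>) / N"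
    by (subst nn_integral_pmf_of_set) auto
  finally show ?thesis by (simp add: shift)
qed

lemma prob_space_gaussian_model: "prob_space (gaussian_model N p d)"
proof -
  let ?\<kappa> = "density lborel (normal_density 0 1)"
  interpret \<mu>: prob_space "moment_design N p" by (rule prob_space_moment_design)
  interpret \<kappa>: prob_space ?\<kappa> by (rule prob_space_normal_density) simp
  interpret Q: pair_prob_space "moment_design N p" ?\<kappa> ..
  show ?thesis unfolding gaussian_model_def change_plane_law_def
    by (rule Q.prob_space_distr) measurable
qed

definition gaussian_ratio ::
    "nat \<Rightarrow> (nat \<Rightarrow> real) \<Rightarrow> (nat \<Rightarrow> real) \<Rightarrow> (nat \<Rightarrow> real) \<times> real \<Rightarrow> real" where
  "gaussian_ratio p d d' = (\<lambda>(x, y).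
     normal_density (plane_ind p d' x) 1 y / normal_density (plane_ind p d x) 1 y)"

lemma measurable_gaussian_ratio [measurable]:
  "gaussian_ratio p d d' \<in> borel_measurable (euclid p \<Otimes>\<^sub>M borel)"
  unfolding gaussian_ratio_def normal_density_def by measurable

lemma gaussian_ratio_nonneg: "0 \<le> gaussian_ratio p d d' z"
  by (auto simp: gaussian_ratio_def split: prod.split)

text \<open>
  The two models share the law of \<open>X\<close>, so that the likelihood ratio is the ratio of the conditional
  densities of \<open>Y\<close> given \<open>X\<close>.
\<close>

lemma gaussian_model_density:
  assumes "0 < N"
  shows "gaussian_model N p d' = density (gaussian_model N p d) (gaussian_ratio p d d')"
proof (rule measure_eqI)
  fix A assume "A \<in> sets (gaussian_model N p d')"
  then have [measurable]: "A \<in> sets (euclid p \<Otimes>\<^sub>M borel)" by simp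
  have cancel: "ennreal (normal_density c 1 y) * (ennreal (normal_density c' 1 y / normal_density c 1 y) * r)
      = ennreal (normal_density c' 1 y) * r" for c c' y r
    using normal_density_pos[of 1 c y]
    by (simp add: mult.assoc[symmetric] ennreal_mult[symmetric])
  have "emeasure (density (gaussian_model N p d) (gaussian_ratio p d d')) A
      = (\<integral>\<^sup>+z. ennreal (gaussian_ratio p d d' z) * indicator A z \<partial>gaussian_model N p d)"
    by (subst emeasure_density) auto
  also have "\<dots> = (\<Sum>i<N. \<integral>\<^sup>+y. ennreal (normal_density (plane_ind p d' (moment_point p i)) 1 y)
      * indicator A (moment_point p i, y) \<partial>lborel) / of_nat N"
    by (subst nn_integral_gaussian_model[OF assms])
       (measurable, simp only: gaussian_ratio_def prod.case cancel)
  also have "\<dots> = nn_integral (gaussian_model N p d') (indicator A)"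
    by (rule nn_integral_gaussian_model[OF assms, symmetric]) measurable
  finally show "emeasure (gaussian_model N p d') A
      = emeasure (density (gaussian_model N p d) (gaussian_ratio p d d')) A" by simp
qed simp

text \<open>
  Completing the square shows that \<open>\<phi>\<^sub>b\<^sup>2 / \<phi>\<^sub>a = exp ((b - a)\<^sup>2) * \<phi>\<^sub>c\<close> with \<open>c = 2 * b - a\<close>, where
  \<open>\<phi>\<^sub>a\<close> is the Gaussian density with mean \<open>a\<close> and variance \<open>1\<close>.
\<close>

lemma gaussian_ratio_second_moment:
  assumes "0 < N"
  shows "(\<integral>\<^sup>+z. ennreal ((gaussian_ratio p d d' z)\<^sup>2) \<partial>gaussian_model N p d) =
    (\<Sum>i<N. ennreal (exp ((plane_ind p d' (moment_point p i) - plane_ind p d (moment_point p i))\<^sup>2))) / of_nat N"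
proof -
  have square: "normal_density c 1 y * (normal_density c' 1 y / normal_density c 1 y)\<^sup>2
      = exp ((c' - c)\<^sup>2) * normal_density (2 * c' - c) 1 y" for c c' y :: real
  proof -
    define s where "s = sqrt (2 * pi)"
    have s: "0 < s" by (simp add: s_def)
    have nd: "normal_density m 1 y = exp (- (y - m)\<^sup>2 / 2) / s" for m
      by (simp add: normal_density_def s_def)
    have "normal_density c 1 y * (normal_density c' 1 y / normal_density c 1 y)\<^sup>2
        = (normal_density c' 1 y)\<^sup>2 / normal_density c 1 y"
      using normal_density_pos[of 1 c y] by (simp add: power2_eq_square)
    also have "\<dots> = exp (2 * (- (y - c')\<^sup>2 / 2) - (- (y - c)\<^sup>2 / 2)) / s"
      using s unfolding exp_diff exp_double by (simp add: nd power2_eq_square)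
    also have "2 * (- (y - c')\<^sup>2 / 2) - (- (y - c)\<^sup>2 / 2) = (c' - c)\<^sup>2 + - (y - (2 * c' - c))\<^sup>2 / 2"
      by (simp add: power2_eq_square field_simps)
    finally show ?thesis by (simp only: nd[of "2 * c' - c"] exp_add times_divide_eq_right)
  qed
  have moment: "(\<integral>\<^sup>+y. normal_density c 1 y * ennreal ((normal_density c' 1 y / normal_density c 1 y)\<^sup>2) \<partial>lborel)
      = ennreal (exp ((c' - c)\<^sup>2))" for c c' :: real
  proof -
    have "(\<integral>\<^sup>+y. normal_density c 1 y * ennreal ((normal_density c' 1 y / normal_density c 1 y)\<^sup>2) \<partial>lborel)
       = ennreal (exp ((c' - c)\<^sup>2)) * (\<integral>\<^sup>+y. normal_density (2 * c' - c) 1 y \<partial>lborel)"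
      by (subst nn_integral_cmult[symmetric])
         (auto simp: ennreal_mult[symmetric] square intro!: nn_integral_cong)
    then show ?thesis by (simp add: nn_integral_normal_density)
  qed
  show ?thesis
    by (subst nn_integral_gaussian_model[OF assms])
       (measurable, simp only: gaussian_ratio_def prod.case moment)
qed

text \<open>
  If the half-spaces differ at one of the \<open>N\<close> design points only, then that point contributes
  \<open>exp 1 \<le> 3\<close> to the average and every other point contributes \<open>1\<close>.
\<close>

lemma gaussian_ratio_second_moment_single:
  assumes "0 < N" and "\<And>i. i < N \<Longrightarrow> i \<noteq> i0 \<Longrightarrow>
    plane_ind p d' (moment_point p i) = plane_ind p d (moment_point p i)"
  shows "(\<integral>\<^sup>+z. ennreal ((gaussian_ratio p d d' z)\<^sup>2) \<partial>gaussian_model N p d) \<le> ennreal (1 + 2 / N)"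
proof -
  let ?e = "\<lambda>i. exp ((plane_ind p d' (moment_point p i) - plane_ind p d (moment_point p i))\<^sup>2)"
  have "(\<Sum>i<N. ?e i) \<le> (\<Sum>i<N. 1 + (if i = i0 then 2 else 0))"
    using assms(2) exp_le by (intro sum_mono) (auto simp: indicator_def)
  also have "\<dots> \<le> N + 2" by (simp add: sum.distrib)
  finally have "(\<Sum>i<N. ?e i) / N \<le> 1 + 2 / N"
    using assms(1) by (simp add: field_simps)
  then show ?thesis
    using assms(1) unfolding gaussian_ratio_second_moment[OF assms(1)]
    by (simp add: ennreal_of_nat_eq_real_of_nat divide_ennreal sum_nonneg ennreal_leI
      del: ennreal_plus)
qed

lemma plane_dist_gaussian_model:
  assumes "0 < N"
  shows "(plane_dist p (gaussian_model N p d) d1 d2)\<^sup>2 =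
    card {i\<in>{..<N}. (0 < dot p (moment_point p i) d1) \<noteq> (0 < dot p (moment_point p i) d2)} / N"
proof -
  let ?P = "gaussian_model N p d"
  let ?D = "\<lambda>x. (0 < dot p x d1) \<noteq> (0 < dot p x d2)"
  interpret prob_space ?P by (rule prob_space_gaussian_model)
  have space: "space ?P = space (euclid p) \<times> UNIV"
    using sets_eq_imp_space_eq[OF sets_gaussian_model[of N p d]] by (simp add: space_pair_measure)
  let ?A = "{z \<in> space (euclid p \<Otimes>\<^sub>M borel). ?D (fst z)}"
  have event: "{(x, y) \<in> space ?P. plane_sign (dot p x d1) \<noteq> plane_sign (dot p x d2)} = ?A"
    by (auto simp: plane_sign_def space space_pair_measure split: if_splits)
  have [measurable]: "?A \<in> sets (euclid p \<Otimes>\<^sub>M borel)" by measurable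
  have "emeasure ?P ?A = nn_integral ?P (indicator ?A)" by simp
  also have "\<dots> = (\<Sum>i<N. if ?D (moment_point p i) then 1 else 0 :: ennreal) / of_nat N"
  proof -
    have point: "(\<integral>\<^sup>+y. ennreal (normal_density c 1 y) * indicator ?A (moment_point p i, y) \<partial>lborel)
        = (if ?D (moment_point p i) then 1 else 0)" for c i
      by (auto simp: space_pair_measure nn_integral_normal_density)
    have "indicator ?A \<in> borel_measurable (euclid p \<Otimes>\<^sub>M borel)"
      by (rule borel_measurable_indicator) measurable
    then show ?thesis
      by (subst nn_integral_gaussian_model[OF assms]) (simp_all only: point)
  qed
  also have "\<dots> = ennreal (card {i\<in>{..<N}. ?D (moment_point p i)} / N)"
    using assms by (simp add: sum.If_cases divide_ennreal ennreal_of_nat_eq_real_of_nat Int_def)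
  finally show ?thesis
    unfolding plane_dist_def event by (simp add: emeasure_eq_measure)
qed

section \<open>The Bayes risk of the block prior\<close>

text \<open>
  The left-hand side averages over \<open>s\<close> and evaluates \<open>G\<close> at the coordinate \<open>s j\<close> that \<open>G s\<close> does not
  see; an independent copy \<open>m\<close> of this coordinate gives the same average. The bijection exchanges
  \<open>m\<close> and \<open>s j\<close>.
\<close>

lemma sum_PiE_coordinate_average:
  fixes G :: "('i \<Rightarrow> 'a) \<Rightarrow> 'a \<Rightarrow> real"
  assumes "j \<in> I" "\<And>s m. G (s(j := m)) = G s"
  shows "real (card A) * (\<Sum>s\<in>PiE I (\<lambda>_. A). G s (s j)) = (\<Sum>s\<in>PiE I (\<lambda>_. A). \<Sum>m\<in>A. G s m)"
proof -
  let ?S = "PiE I (\<lambda>_. A)"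
  have upd: "s(j := m) \<in> ?S" "s j \<in> A" if "s \<in> ?S" "m \<in> A" for s m
    using that assms(1) by (auto simp: PiE_iff extensional_def)
  have "(\<Sum>(s, m)\<in>?S \<times> A. G s (s j)) = (\<Sum>(s, m)\<in>?S \<times> A. G s m)"
    by (rule sum.reindex_bij_witness[of _ "\<lambda>(s, m). (s(j := m), s j)" "\<lambda>(s, m). (s(j := m), s j)"])
       (use upd in \<open>auto simp: assms(2)\<close>)
  then show ?thesis
    by (simp add: sum.cartesian_product[symmetric] sum_distrib_left)
qed

lemma block_index_eq_iff:
  fixes k k' M :: nat
  assumes "k < M" "k' < M"
  shows "j * M + k = j' * M + k' \<longleftrightarrow> j = j' \<and> k = k'"
proof
  assume eq: "j * M + k = j' * M + k'"
  then have "(j * M + k) div M = (j' * M + k') div M" "(j * M + k) mod M = (j' * M + k') mod M"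
    by simp_all
  then show "j = j' \<and> k = k'" using assms by simp
qed simp

lemma block_index_less:
  fixes j k D M :: nat
  assumes "j < D" "k < M"
  shows "j * M + k < D * M"
proof -
  have "j * M + k < Suc j * M" using assms by simp
  also have "\<dots> \<le> D * M" using assms by (intro mult_le_mono1) simp
  finally show ?thesis .
qed

text \<open>
  The prior is uniform on \<open>S\<close>: \<open>s \<in> S\<close> selects the point \<open>j * M + s j\<close> of block \<open>j\<close>, and
  \<open>T J s\<close> collects the selected points of the blocks in \<open>J\<close>. The event \<open>A j m\<close> says that the
  estimated half-space contains the point of index \<open>m\<close>, and no other, of block \<open>j\<close>. Outside
  \<open>A j (s j)\<close> block \<open>j\<close> contains a misclassified point. The risk at some \<open>s\<close> is at least the average
  risk over \<open>S\<close>.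
\<close>

lemma block_prior_risk_bound:
  fixes n p D M :: nat
  assumes D: "0 < D" "2 * D < p" and M: "0 < M"
    and information: "exp (2 * real n / (real D * real M)) \<le> real M / 4"
    and dhat: "dhat \<in> estimators n p"
  shows "\<exists>(d, P)\<in>change_plane_models p. ennreal (1 / (2 * real M)) \<le> plane_risk n p dhat d P"
proof -
  define N where "N = D * M"
  have N: "0 < N" using D M by (simp add: N_def)
  let ?cut = "\<lambda>i d. 0 < dot p (moment_point p i) d"
  have "\<forall>T. \<exists>d. finite T \<and> card T \<le> D \<longrightarrow> d \<in> unit_sphere p \<and> (\<forall>i. ?cut i d \<longleftrightarrow> i \<in> T)"
    using moment_curve_subset_cut[of _ p] D by (metis le_less_trans mult_le_mono2)
  then obtain dir where dir: "\<And>T. finite T \<Longrightarrow> card T \<le> D \<Longrightarrow> dir T \<in> unit_sphere p"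
    "\<And>T i. finite T \<Longrightarrow> card T \<le> D \<Longrightarrow> ?cut i (dir T) \<longleftrightarrow> i \<in> T"
    by metis
  define P where "P T = gaussian_model N p (dir T)" for T
  define PP where "PP T = (\<Pi>\<^sub>M i\<in>{..<n}. P T)" for T
  define T where "T J s = (\<lambda>j. j * M + s j) ` J" for J and s :: "nat \<Rightarrow> nat"
  define S where "S = ({..<D} \<rightarrow>\<^sub>E {..<M})"
  let ?X = "\<Pi>\<^sub>M i\<in>{..<n}. euclid p \<Otimes>\<^sub>M borel"
  define A where "A j m = {\<omega> \<in> space ?X. \<forall>k<M. ?cut (j * M + k) (dhat \<omega>) \<longleftrightarrow> k = m}" for j m
  have S: "finite S" "0 < card S" "\<And>s j. s \<in> S \<Longrightarrow> j < D \<Longrightarrow> s j < M"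
    using M by (auto simp: S_def finite_PiE card_PiE)
  have T: "finite (T J s)" "card (T J s) \<le> D" if "J \<subseteq> {..<D}" for J s
    using that card_image_le[of J "\<lambda>j. j * M + s j"] card_mono[OF _ that] finite_subset[OF that]
    by (auto simp: T_def intro: le_trans)
  have mem_T: "j * M + k \<in> T J s \<longleftrightarrow> j \<in> J \<and> k = s j" if "s \<in> S" "J \<subseteq> {..<D}" "k < M" for J s j k
    using that S(3)[of s] by (auto simp: T_def image_iff block_index_eq_iff subset_eq)
  have sets_PP: "sets (PP T) = sets ?X" for T
    unfolding PP_def P_def by (intro sets_PiM_cong) auto
  have space_PP: "space (PP T) = space ?X" for T
    by (rule sets_eq_imp_space_eq[OF sets_PP])
  have prob_PP: "prob_space (PP T)" for T
    unfolding PP_def P_def by (intro prob_space_PiM prob_space_gaussian_model)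
  have "dhat \<in> ?X \<rightarrow>\<^sub>M euclid p"
    using dhat by (simp add: estimators_def measurable_restrict_space2_iff)
  then have [measurable]: "(\<lambda>\<omega>. dot p x (dhat \<omega>)) \<in> borel_measurable ?X" for x
    by (rule measurable_compose[OF _ measurable_dot_right])
  have A_X [measurable]: "A j m \<in> sets ?X" for j m
    unfolding A_def by measurable
  have A_sets: "A j m \<in> sets (PP T)" for j m T using A_X sets_PP by simp

  \<comment> \<open>The weight \<open>a = 1 / M\<close> balances the second moment \<open>M / 4\<close> against the average probability
    \<open>1 / M\<close> of a correct guess without information: each of the two terms contributes \<open>1 / 4\<close>.\<close>
  have information_step: "measure (PP (T {..<D} s)) (A j (s j))
      \<le> 1 / 4 + real M / 4 * measure (PP (T ({..<D} - {j}) s)) (A j (s j))"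
    if s: "s \<in> S" and j: "j < D" for s j
  proof -
    let ?d = "dir (T ({..<D} - {j}) s)" and ?d' = "dir (T {..<D} s)"
    have PP: "PP (T {..<D} s)
        = (\<Pi>\<^sub>M i\<in>{..<n}. density (P (T ({..<D} - {j}) s)) (\<lambda>z. ennreal (gaussian_ratio p ?d ?d' z)))"
      unfolding PP_def P_def by (subst gaussian_model_density[OF N]) simp
    have "(1 + 2 / real N) ^ n \<le> exp (2 / real N) ^ n"
      by (intro power_mono exp_ge_add_one_self) auto
    also have "\<dots> = exp (2 * real n / (real D * real M))"
      by (simp add: exp_of_nat_mult[symmetric] N_def)
    finally have "(1 + 2 / real N) ^ n \<le> real M / 4" using information by simp
    then have power: "1 / real M * (1 + 2 / real N) ^ n \<le> 1 / 4"
      using M by (simp add: field_simps)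
    have "T {..<D} s = insert (j * M + s j) (T ({..<D} - {j}) s)"
      using j by (auto simp: T_def)
    then have same: "plane_ind p ?d' (moment_point p i) = plane_ind p ?d (moment_point p i)"
      if "i \<noteq> j * M + s j" for i
      using that T[of "{..<D}" s] T[of "{..<D} - {j}" s] by (auto simp: indicator_def dir)
    have "measure (PP (T {..<D} s)) (A j (s j)) \<le> 1 / real M * (1 + 2 / real N) ^ card {..<n}
        + measure (PP (T ({..<D} - {j}) s)) (A j (s j)) / (4 * (1 / real M))"
      unfolding PP unfolding PP_def
    proof (rule likelihood_ratio_event_bound)
      show "(\<integral>\<^sup>+z. ennreal ((gaussian_ratio p ?d ?d' z)\<^sup>2) \<partial>P (T ({..<D} - {j}) s))
          \<le> ennreal (1 + 2 / real N)"
        unfolding P_def using same by (intro gaussian_ratio_second_moment_single[OF N]) auto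
      show "prob_space (density (P (T ({..<D} - {j}) s)) (\<lambda>z. ennreal (gaussian_ratio p ?d ?d' z)))"
        using gaussian_model_density[OF N, of p ?d' ?d] prob_space_gaussian_model[of N p ?d']
        by (simp add: P_def)
      show "A j (s j) \<in> sets (\<Pi>\<^sub>M i\<in>{..<n}. P (T ({..<D} - {j}) s))"
        using A_sets by (simp add: PP_def)
    qed (use M in \<open>auto simp: P_def prob_space_gaussian_model gaussian_ratio_nonneg\<close>)
    also have "\<dots> = 1 / real M * (1 + 2 / real N) ^ n
        + real M / 4 * measure (PP (T ({..<D} - {j}) s)) (A j (s j))"
      by simp
    also have "\<dots> \<le> 1 / 4 + real M / 4 * measure (PP (T ({..<D} - {j}) s)) (A j (s j))"
      by (rule add_right_mono[OF power])
    finally show ?thesis .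
  qed

  have "A j m \<inter> A j m' = {}" if "m < M" "m \<noteq> m'" for j m m'
    using that unfolding A_def by blast
  then have disjoint: "disjoint_family_on (A j) {..<M}" for j
    by (simp add: disjoint_family_on_def)

  \<comment> \<open>The model without the point of block \<open>j\<close> does not depend on \<open>s j\<close>, and the \<open>M\<close> possible answers for
    this block are disjoint events.\<close>
  have few_correct: "(\<Sum>s\<in>S. measure (PP (T {..<D} s)) (A j (s j))) \<le> real (card S) / 2"
    if j: "j < D" for j
  proof -
    define G where "G s m = measure (PP (T ({..<D} - {j}) s)) (A j m)" for s m
    have "T ({..<D} - {j}) (s(j := m)) = T ({..<D} - {j}) s" for s m
      unfolding T_def by (intro image_cong) auto
    then have "real (card {..<M}) * (\<Sum>s\<in>S. G s (s j)) = (\<Sum>s\<in>S. \<Sum>m<M. G s m)"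
      unfolding S_def using j by (intro sum_PiE_coordinate_average) (auto simp: G_def fun_eq_iff)
    also have "\<dots> \<le> (\<Sum>s\<in>S. 1)"
    proof (rule sum_mono)
      fix s
      interpret prob_space "PP (T ({..<D} - {j}) s)" by (rule prob_PP)
      have "(\<Sum>m<M. G s m) = prob (\<Union>m<M. A j m)"
        unfolding G_def using A_sets disjoint
        by (intro finite_measure_finite_Union[symmetric]) auto
      then show "(\<Sum>m<M. G s m) \<le> 1" by simp
    qed
    finally have "real M * (\<Sum>s\<in>S. G s (s j)) \<le> card S" by simp
    moreover have "(\<Sum>s\<in>S. measure (PP (T {..<D} s)) (A j (s j)))
        \<le> (\<Sum>s\<in>S. 1 / 4 + real M / 4 * G s (s j))"
      unfolding G_def using j by (intro sum_mono information_step)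
    moreover have "\<dots> = real (card S) / 4 + (real M * (\<Sum>s\<in>S. G s (s j))) / 4"
      by (simp add: sum.distrib sum_distrib_left sum_divide_distrib)
    ultimately show ?thesis by simp
  qed

  have risk: "ennreal ((\<Sum>j<D. 1 - measure (PP (T {..<D} s)) (A j (s j))) / N)
      \<le> plane_risk n p dhat (dir (T {..<D} s)) (P (T {..<D} s))" if s: "s \<in> S" for s
  proof -
    let ?T = "T {..<D} s"
    interpret prob_space "PP ?T" by (rule prob_PP)
    have loss: "(\<Sum>j<D. indicator (space ?X - A j (s j)) \<omega>) / N
        \<le> (plane_dist p (P ?T) (dhat \<omega>) (dir ?T))\<^sup>2" if \<omega>: "\<omega> \<in> space ?X" for \<omega>
    proof -
      let ?W = "{j\<in>{..<D}. \<omega> \<notin> A j (s j)}"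
      let ?E = "{i\<in>{..<N}. ?cut i (dhat \<omega>) \<noteq> ?cut i (dir ?T)}"
      have "\<forall>j\<in>?W. \<exists>k<M. ?cut (j * M + k) (dhat \<omega>) \<noteq> (k = s j)"
        using \<omega> by (auto simp: A_def)
      then obtain k where "\<forall>j\<in>?W. k j < M \<and> ?cut (j * M + k j) (dhat \<omega>) \<noteq> (k j = s j)"
        by (rule bchoice[THEN exE])
      then have k: "k j < M \<and> ?cut (j * M + k j) (dhat \<omega>) \<noteq> (k j = s j)" if "j \<in> ?W" for j
        using that by (rule bspec)
      \<comment> \<open>Each block in which the estimator errs supplies a misclassified point of its own.\<close>
      have "card ?W \<le> card ?E"
      proof (rule card_inj_on_le)
        show "inj_on (\<lambda>j. j * M + k j) ?W"
          by (rule inj_onI) (use k block_index_eq_iff in blast)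
        show "(\<lambda>j. j * M + k j) ` ?W \<subseteq> ?E"
        proof (rule image_subsetI)
          fix j assume j: "j \<in> ?W"
          then have "?cut (j * M + k j) (dir ?T) \<longleftrightarrow> k j = s j"
            using T[of "{..<D}" s] k[OF j] s by (simp add: dir mem_T)
          then show "j * M + k j \<in> ?E"
            using j k[OF j] block_index_less[of j D "k j" M] by (simp add: N_def)
        qed
      qed simp
      moreover have "(\<Sum>j<D. indicator (space ?X - A j (s j)) \<omega>) = real (card ?W)"
        using \<omega> by (simp add: indicator_def sum.If_cases Int_def)
      ultimately show ?thesis
        unfolding P_def plane_dist_gaussian_model[OF N] by (simp add: divide_right_mono)
    qed
    have "ennreal ((\<Sum>j<D. 1 - prob (A j (s j))) / N)
        = ennreal (1 / N) * (\<Sum>j<D. emeasure (PP ?T) (space ?X - A j (s j)))"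
      using prob_compl[OF A_sets]
      by (simp add: emeasure_eq_measure space_PP ennreal_mult[symmetric] sum_nonneg del: ennreal_1)
    also have "\<dots> = (\<integral>\<^sup>+\<omega>. ennreal (1 / N) * (\<Sum>j<D. indicator (space ?X - A j (s j)) \<omega>) \<partial>PP ?T)"
      using A_sets[of _ _ ?T] sets_PP[of ?T] sets.Diff[OF sets.top A_X]
      by (simp add: nn_integral_cmult nn_integral_sum)
    also have "\<dots> = (\<integral>\<^sup>+\<omega>. ennreal ((\<Sum>j<D. indicator (space ?X - A j (s j)) \<omega>) / N) \<partial>PP ?T)"
    proof (rule nn_integral_cong)
      fix \<omega>
      have "(\<Sum>j<D. indicator (space ?X - A j (s j)) \<omega>)
          = ennreal (\<Sum>j<D. indicator (space ?X - A j (s j)) \<omega>)"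
        by (simp add: ennreal_indicator[symmetric] del: ennreal_indicator)
      then show "ennreal (1 / N) * (\<Sum>j<D. indicator (space ?X - A j (s j)) \<omega>)
          = ennreal ((\<Sum>j<D. indicator (space ?X - A j (s j)) \<omega>) / N)"
        by (simp add: ennreal_mult[symmetric] sum_nonneg)
    qed
    also have "\<dots> \<le> plane_risk n p dhat (dir ?T) (P ?T)"
      unfolding plane_risk_def PP_def[symmetric]
      by (intro nn_integral_mono ennreal_leI loss) (simp add: space_PP)
    finally show ?thesis .
  qed

  have "\<exists>s\<in>S. 1 / (2 * real M) \<le> (\<Sum>j<D. 1 - measure (PP (T {..<D} s)) (A j (s j))) / N"
  proof (rule ccontr)
    assume "\<not> ?thesis"
    then have "(\<Sum>s\<in>S. (\<Sum>j<D. 1 - measure (PP (T {..<D} s)) (A j (s j))) / N) < (\<Sum>s\<in>S. 1 / (2 * real M))"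
      using S by (intro sum_strict_mono) auto
    then have "(\<Sum>s\<in>S. \<Sum>j<D. 1 - measure (PP (T {..<D} s)) (A j (s j))) < real (card S) * real D / 2"
      using N M by (simp add: sum_divide_distrib[symmetric] N_def field_simps)
    moreover have "(\<Sum>s\<in>S. \<Sum>j<D. 1 - measure (PP (T {..<D} s)) (A j (s j)))
        = (\<Sum>j<D. real (card S) - (\<Sum>s\<in>S. measure (PP (T {..<D} s)) (A j (s j))))"
      by (subst sum.swap) (simp add: sum_subtractf)
    moreover have "\<dots> \<ge> (\<Sum>j<D. real (card S) / 2)"
      using few_correct by (intro sum_mono) fastforce
    ultimately show False by (simp add: field_simps)
  qed
  then obtain s where s: "s \<in> S"
    "1 / (2 * real M) \<le> (\<Sum>j<D. 1 - measure (PP (T {..<D} s)) (A j (s j))) / N" by blast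
  have "(dir (T {..<D} s), P (T {..<D} s)) \<in> change_plane_models p"
    unfolding P_def using T[of "{..<D}" s] by (intro gaussian_model_admissible dir) auto
  moreover have "ennreal (1 / (2 * real M)) \<le> plane_risk n p dhat (dir (T {..<D} s)) (P (T {..<D} s))"
    using ennreal_leI[OF s(2)] risk[OF s(1)] by (rule order_trans)
  ultimately show ?thesis by (intro bexI[of _ "(dir (T {..<D} s), P (T {..<D} s))"]) auto
qed

section \<open>The choice of the block size\<close>

text \<open>
  For \<open>M \<ge> 16 * u / ln u\<close> the exponential is at most \<open>sqrt u\<close>, which is at most
  \<open>4 * u / ln u\<close> because \<open>ln u \<le> 2 * sqrt u\<close>. Rounding up costs \<open>1 \<le> u / ln u\<close>, and \<open>1 + ln u \<le> 2 * ln u\<close>;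
  this gives the constant \<open>68 = 2 * 17 * 2\<close>.
\<close>

lemma block_size_exists:
  fixes u :: real
  assumes "exp 1 \<le> u"
  shows "\<exists>M::nat. 0 < M \<and> exp (8 * u / real M) \<le> real M / 4 \<and> (1 + ln u) / (68 * u) \<le> 1 / (2 * real M)"
proof -
  define v where "v = 16 * u / ln u"
  define M where "M = nat \<lceil>v\<rceil>"
  have u: "0 < u" using assms exp_gt_zero[of 1] by linarith
  then have ln1: "1 \<le> ln u" using assms by (simp add: ln_ge_iff)
  then have ln0: "0 < ln u" by linarith
  have ln_u: "ln u \<le> u" using u by (simp add: ln_bound)
  have v: "16 \<le> v" using ln0 ln1 ln_u u by (simp add: v_def field_simps)
  then have M: "v \<le> M" "M \<le> v + 1" "0 < real M" by (auto simp: M_def)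
  have "8 * u / M \<le> 8 * u / v"
    using M(1) v u by (intro divide_left_mono) auto
  also have "\<dots> = ln u / 2" using ln0 ln1 u by (simp add: v_def)
  finally have "exp (8 * u / M) \<le> exp (ln u / 2)" by simp
  also have "\<dots> = sqrt u" using u by (simp add: powr_half_sqrt[symmetric] powr_def)
  also have "sqrt u \<le> v / 4"
  proof -
    have "ln (sqrt u) \<le> sqrt u" using u by (intro ln_bound) simp
    then have "ln u \<le> 2 * sqrt u" using u by (simp add: ln_sqrt)
    then have "sqrt u * ln u \<le> sqrt u * (2 * sqrt u)" using u by (intro mult_left_mono) auto
    also have "\<dots> \<le> 4 * u" using u by simp
    finally show ?thesis using ln0 ln1 by (simp add: v_def field_simps)
  qed
  also have "v / 4 \<le> M / 4" using M by simp
  finally have "exp (8 * u / M) \<le> M / 4" .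
  moreover have "(1 + ln u) / (68 * u) \<le> 1 / (2 * M)"
  proof -
    have "v + 1 \<le> 17 * u / ln u" using ln0 ln1 ln_u by (simp add: v_def field_simps)
    then have "real M \<le> 17 * u / ln u" using M(2) by linarith
    then have "M * ln u \<le> 17 * u" using ln0 by (simp add: field_simps)
    moreover have "M * (1 + ln u) \<le> M * (2 * ln u)" using ln0 ln1 M by (intro mult_left_mono) auto
    ultimately have "M * (1 + ln u) \<le> 34 * u" by linarith
    then show ?thesis using u M by (simp add: field_simps)
  qed
  ultimately show ?thesis using M by auto
qed

theorem theorem3p7:
  fixes p :: "nat \<Rightarrow> nat"
  assumes "filterlim p at_top sequentially"
    and "(\<lambda>n. real (p n) / real n) \<longlonglongrightarrow> 0"
  shows "\<exists>K::real. K > 0 \<and>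
    (\<forall>\<^sub>F n in sequentially.
      (INF dhat \<in> estimators n (p n). SUP (d, P) \<in> change_plane_models (p n).
         plane_risk n (p n) dhat d P)
      \<ge> ennreal (K * (real (p n) / real n) * (1 + ln (real n / real (p n)))))"
proof (intro exI[of _ "1 / 68"] conjI)
  have "\<forall>\<^sub>F n in sequentially. 4 \<le> p n"
    using assms(1) by (simp add: filterlim_at_top)
  moreover have "\<forall>\<^sub>F n in sequentially. real (p n) / real n < exp (- 1)"
    using assms(2) by (rule order_tendstoD) simp
  ultimately show "\<forall>\<^sub>F n in sequentially.
      (INF dhat \<in> estimators n (p n). SUP (d, P) \<in> change_plane_models (p n).
         plane_risk n (p n) dhat d P)
      \<ge> ennreal (1 / 68 * (real (p n) / real n) * (1 + ln (real n / real (p n))))"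
    using eventually_gt_at_top[of 0]
  proof eventually_elim
    case (elim n)
    define u where "u = real n / real (p n)"
    \<comment> \<open>The largest number of points that \<open>moment_curve_subset_cut\<close> can separate.\<close>
    define D where "D = (p n - 1) div 2"
    have D: "0 < D" "2 * D < p n" and D4: "real (p n) \<le> 4 * real D"
      using elim(1) by (auto simp: D_def)
    have "exp 1 \<le> u"
      using elim unfolding u_def exp_minus by (simp add: field_simps)
    then obtain M where M: "0 < M" "exp (8 * u / real M) \<le> real M / 4"
      "(1 + ln u) / (68 * u) \<le> 1 / (2 * real M)"
      using block_size_exists by blast
    have "2 * real n / (real D * real M) \<le> 8 * u / real M"
      using D D4 M elim by (simp add: u_def field_simps)
    then have information: "exp (2 * real n / (real D * real M)) \<le> real M / 4"
      using M(2) by (meson exp_le_cancel_iff order_trans)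
    have rate: "1 / 68 * (real (p n) / real n) * (1 + ln u) \<le> 1 / (2 * real M)"
      using M(3) by (simp add: u_def mult.commute)
    show ?case
    proof (rule INF_greatest)
      fix dhat assume "dhat \<in> estimators n (p n)"
      then obtain d P where "(d, P) \<in> change_plane_models (p n)"
        "ennreal (1 / (2 * real M)) \<le> plane_risk n (p n) dhat d P"
        using block_prior_risk_bound[OF D M(1) information] by blast
      moreover from this(2)
      have "ennreal (1 / 68 * (real (p n) / real n) * (1 + ln u)) \<le> plane_risk n (p n) dhat d P"
        by (rule order_trans[OF ennreal_leI[OF rate]])
      ultimately show "ennreal (1 / 68 * (real (p n) / real n) * (1 + ln (real n / real (p n))))
          \<le> (SUP (d, P) \<in> change_plane_models (p n). plane_risk n (p n) dhat d P)"
        unfolding u_def by (intro SUP_upper2[of "(d, P)"]) simp_all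
    qed
  qed
qed simp

end
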